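(* Let $(A,\cdot_A)$ be a perm algebra and $r\in A\otimes A$ such that its skew-symmetric part $\frac12(r-\sigma(r))$ is $(R,\mathrm{ad})$-invariant. Then the following conditions are equivalent. (1) $r$ is a solution of the perm Yang-Baxter equation in $(A,\cdot_A)$ such that $(A,\cdot_A,\Delta_r)$ is a quasi-triangular perm bialgebra. (2) $T_r$ is a relative Rota-Baxter operator of weight $-1$ on $(A,\cdot_A)$ with respect to the $A$-perm algebra $(A^*,L^*,\mathrm{ad}^*,\diamond_{r-\sigma(r)})$, where the multiplication $\diamond_{r-\sigma(r)}$ is defined by $a^*\diamond_{r-\sigma(r)}b^*=L^*(T_{r-\sigma(r)}(a^* ))b^*$ for all $a^*,b^*\in A^*$. That is, the following equation holds: $$T_r(a^* )\cdot_A T_r(b^* )=T_r\big(L^*(T_r(a^* ))b^*+\mathrm{ad}^*(T_r(b^* ))a^*-a^*\diamond_{r-\sigma(r)}b^*\big),\quad\forall a^*,b^*\in A^*.$$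
   Context: Conventions: the base field $\mathbb K$ has characteristic zero; all vector spaces and algebras are finite-dimensional. For a bilinear operation $\cdot_A$ on $A$: $L(a)b=a\cdot_A b$, $R(a)b=b\cdot_A a$, $\mathrm{ad}(a)=L(a)-R(a)$. For $\mu:A\to\mathrm{End}(V)$, $\mu^*:A\to\mathrm{End}(V^* )$ is $\langle\mu^*(a)v^*,v\rangle=\langle v^*,\mu(a)v\rangle$ (no sign). $\sigma(u\otimes v)=v\otimes u$. Perm algebra: a vector space $A$ with bilinear $\cdot_A$ such that $a\cdot_A(b\cdot_A c)=(a\cdot_A b)\cdot_A c=(b\cdot_A a)\cdot_A c$ for all $a,b,c\in A$. Perm coalgebra: $(A,\Delta)$ with $\Delta:A\to A\otimes A$ linear and $(\Delta\otimes\mathrm{id})\Delta=(\mathrm{id}\otimes\Delta)\Delta=(\sigma\otimes\mathrm{id})(\Delta\otimes\mathrm{id})\Delta$. Perm bialgebra: $(A,\cdot_A,\Delta)$ with $(A,\cdot_A)$ a perm algebra, $(A,\Delta)$ a perm coalgebra, and for all $a,b\in A$: $\Delta(a\cdot_A b)=(\mathrm{ad}(a)\otimes\mathrm{id})\Delta(b)+(\mathrm{id}\otimes R(b))\Delta(a)$; $\sigma(R(b)\otimes\mathrm{id})\Delta(a)=(R(a)\otimes\mathrm{id})\Delta(b)$; $\Delta(a\cdot_A b)=(\mathrm{id}\otimes L(a))\Delta(b)+(\mathrm{ad}(b)\otimes\mathrm{id})(\Delta(a)-\sigma\Delta(a))$. For $r=\sum_i a_i\otimes b_i\in A\otimes A$: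 $T_r:A^*\to A$, $T_r(a^* )=\sum_i\langle a^*,a_i\rangle b_i$; $\Delta_r(a)=(\mathrm{id}\otimes R(a)-\mathrm{ad}(a)\otimes\mathrm{id})(r)$. $r$ is a solution of the perm Yang-Baxter equation in $(A,\cdot_A)$ if $\sum_{i,j}\big(a_i\otimes b_i\cdot_A a_j\otimes b_j-a_i\otimes a_j\otimes b_i\cdot_A b_j+a_i\cdot_A a_j\otimes b_i\otimes b_j-a_j\cdot_A a_i\otimes b_i\otimes b_j\big)=0$. $s\in A\otimes A$ is $(R,\mathrm{ad})$-invariant if $(\mathrm{id}\otimes R(a)-\mathrm{ad}(a)\otimes\mathrm{id})(s)=0$ for all $a\in A$. Quasi-triangular perm bialgebra: a perm bialgebra $(A,\cdot_A,\Delta_r)$ where $r$ solves the perm Yang-Baxter equation and $\frac12(r-\sigma(r))$ is $(R,\mathrm{ad})$-invariant. Representation of $(A,\cdot_A)$: $(V,l,\rho)$ with $l,\rho:A\to\mathrm{End}(V)$ linear, $l(a\cdot_A b)=l(a)l(b)=l(b)l(a)$ and $\rho(a\cdot_A b)=\rho(b)\rho(a)=\rho(b)l(a)=l(a)\rho(b)$ for all $a,b\in A$. $A$-perm algebra: $(V,l,\rho,\cdot_V)$ with $(V,\cdot_V)$ a perm algebra, $(V,l,\rho)$ a representation of $(A,\cdot_A)$, and for all $a\in A$, $u,w\in V$: $\rho(a)(u\cdot_V w)=\rho(a)(w\cdot_V u)=u\cdot_V(\rho(a)w)$ and $(l(a)u)\cdot_V w=(\rho(a)u)\cdot_V w=l(a)(u\cdot_V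 w)=u\cdot_V(l(a)w)$. Relative Rota-Baxter operator of weight $\lambda\in\mathbb K$ on $(A,\cdot_A)$ with respect to an $A$-perm algebra $(V,l,\rho,\cdot_V)$: a linear map $T:V\to A$ with $T(u)\cdot_A T(w)=T(l(T(u))w+\rho(T(w))u+\lambda\,u\cdot_V w)$ for all $u,w\in V$. *)

theory Defs
  imports Complex_Main "HOL-Library.Poly_Mapping" "HOL-Library.Function_Algebras"
begin

section \<open>Finite-dimensional vector spaces and linear maps on a carrier\<close>

text \<open>Vector spaces are carriers inside an additive group type, with an explicit scalar
  multiplication; a whole type is the case \<^term>\<open>V = UNIV\<close>. The carrier is needed because the
  dual space is a proper subset of a function type.\<close>

definition fd_space :: "('k::field \<Rightarrow> 'v::ab_group_add \<Rightarrow> 'v) \<Rightarrow> 'v set \<Rightarrow> bool" where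
  "fd_space s V \<longleftrightarrow> vector_space s \<and> (\<exists>B. finite B \<and> V = module.span s B)"

definition linear_on ::
  "('k::field \<Rightarrow> 'v::ab_group_add \<Rightarrow> 'v) \<Rightarrow> 'v set \<Rightarrow>
   ('k \<Rightarrow> 'w::ab_group_add \<Rightarrow> 'w) \<Rightarrow> 'w set \<Rightarrow> ('v \<Rightarrow> 'w) \<Rightarrow> bool" where
  "linear_on s V s' W f \<longleftrightarrow>
     (\<forall>x\<in>V. f x \<in> W) \<and>
     (\<forall>x\<in>V. \<forall>y\<in>V. f (x + y) = f x + f y) \<and>
     (\<forall>c. \<forall>x\<in>V. f (s c x) = s' c (f x))"

definition bilinear_on ::
  "('k::field \<Rightarrow> 'u::ab_group_add \<Rightarrow> 'u) \<Rightarrow> 'u set \<Rightarrow>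
   ('k \<Rightarrow> 'v::ab_group_add \<Rightarrow> 'v) \<Rightarrow> 'v set \<Rightarrow>
   ('k \<Rightarrow> 'w::ab_group_add \<Rightarrow> 'w) \<Rightarrow> 'w set \<Rightarrow> ('u \<Rightarrow> 'v \<Rightarrow> 'w) \<Rightarrow> bool" where
  "bilinear_on s U s' V s'' W f \<longleftrightarrow>
     (\<forall>x\<in>U. linear_on s' V s'' W (f x)) \<and>
     (\<forall>y\<in>V. linear_on s U s'' W (\<lambda>x. f x y))"

definition dual :: "('k::field \<Rightarrow> 'a::ab_group_add \<Rightarrow> 'a) \<Rightarrow> ('a \<Rightarrow> 'k) set" where
  "dual s = {f. Vector_Spaces.linear s (*) f}"

definition dscale :: "'k::field \<Rightarrow> ('a \<Rightarrow> 'k) \<Rightarrow> 'a \<Rightarrow> 'k" where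
  "dscale c f = (\<lambda>x. c * f x)"

text \<open>The (sign-free) transpose \<open>\<mu>\<^sup>*\<close> of \<open>\<mu> : A \<rightarrow> End(V)\<close>.\<close>

definition dual_map :: "('a \<Rightarrow> 'v \<Rightarrow> 'v) \<Rightarrow> 'a \<Rightarrow> ('v \<Rightarrow> 'k) \<Rightarrow> 'v \<Rightarrow> 'k" where
  "dual_map \<mu> a f = (\<lambda>v. f (\<mu> a v))"


section \<open>Perm algebras, representations, relative Rota-Baxter operators\<close>

definition Lmul :: "('a \<Rightarrow> 'a \<Rightarrow> 'a) \<Rightarrow> 'a \<Rightarrow> 'a \<Rightarrow> 'a" where
  "Lmul m a b = m a b"

definition Rmul :: "('a \<Rightarrow> 'a \<Rightarrow> 'a) \<Rightarrow> 'a \<Rightarrow> 'a \<Rightarrow> 'a" where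
  "Rmul m a b = m b a"

definition ad :: "('a::ab_group_add \<Rightarrow> 'a \<Rightarrow> 'a) \<Rightarrow> 'a \<Rightarrow> 'a \<Rightarrow> 'a" where
  "ad m a b = Lmul m a b - Rmul m a b"

definition perm_algebra ::
  "('k::field \<Rightarrow> 'v::ab_group_add \<Rightarrow> 'v) \<Rightarrow> 'v set \<Rightarrow> ('v \<Rightarrow> 'v \<Rightarrow> 'v) \<Rightarrow> bool" where
  "perm_algebra s V m \<longleftrightarrow>
     fd_space s V \<and> bilinear_on s V s V s V m \<and>
     (\<forall>a\<in>V. \<forall>b\<in>V. \<forall>c\<in>V. m a (m b c) = m (m a b) c \<and> m (m a b) c = m (m b a) c)"

text \<open>In the following definitions \<open>A\<close> is the whole type \<^typ>\<open>'a\<close>, with scalar multiplication \<open>s\<close>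
  and product \<open>m\<close>, while \<open>V\<close> is a carrier.\<close>

definition perm_representation ::
  "('k::field \<Rightarrow> 'a::ab_group_add \<Rightarrow> 'a) \<Rightarrow> ('a \<Rightarrow> 'a \<Rightarrow> 'a) \<Rightarrow>
   ('k \<Rightarrow> 'v::ab_group_add \<Rightarrow> 'v) \<Rightarrow> 'v set \<Rightarrow> ('a \<Rightarrow> 'v \<Rightarrow> 'v) \<Rightarrow> ('a \<Rightarrow> 'v \<Rightarrow> 'v) \<Rightarrow> bool" where
  "perm_representation s m sV V l \<rho> \<longleftrightarrow>
     perm_algebra s UNIV m \<and> fd_space sV V \<and>
     bilinear_on s UNIV sV V sV V l \<and> bilinear_on s UNIV sV V sV V \<rho> \<and>
     (\<forall>a b. \<forall>v\<in>V.
        l (m a b) v = l a (l b v) \<and> l a (l b v) = l b (l a v) \<and>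
        \<rho> (m a b) v = \<rho> b (\<rho> a v) \<and> \<rho> b (\<rho> a v) = \<rho> b (l a v) \<and> \<rho> b (l a v) = l a (\<rho> b v))"

definition A_perm_algebra ::
  "('k::field \<Rightarrow> 'a::ab_group_add \<Rightarrow> 'a) \<Rightarrow> ('a \<Rightarrow> 'a \<Rightarrow> 'a) \<Rightarrow>
   ('k \<Rightarrow> 'v::ab_group_add \<Rightarrow> 'v) \<Rightarrow> 'v set \<Rightarrow> ('a \<Rightarrow> 'v \<Rightarrow> 'v) \<Rightarrow> ('a \<Rightarrow> 'v \<Rightarrow> 'v) \<Rightarrow>
   ('v \<Rightarrow> 'v \<Rightarrow> 'v) \<Rightarrow> bool" where
  "A_perm_algebra s m sV V l \<rho> mV \<longleftrightarrow>
     perm_algebra sV V mV \<and> perm_representation s m sV V l \<rho> \<and>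
     (\<forall>a. \<forall>u\<in>V. \<forall>w\<in>V.
        \<rho> a (mV u w) = \<rho> a (mV w u) \<and> \<rho> a (mV w u) = mV u (\<rho> a w) \<and>
        mV (l a u) w = mV (\<rho> a u) w \<and> mV (\<rho> a u) w = l a (mV u w) \<and>
        l a (mV u w) = mV u (l a w))"

definition relative_RB_operator ::
  "('k::field \<Rightarrow> 'a::ab_group_add \<Rightarrow> 'a) \<Rightarrow> ('a \<Rightarrow> 'a \<Rightarrow> 'a) \<Rightarrow>
   ('k \<Rightarrow> 'v::ab_group_add \<Rightarrow> 'v) \<Rightarrow> 'v set \<Rightarrow> ('a \<Rightarrow> 'v \<Rightarrow> 'v) \<Rightarrow> ('a \<Rightarrow> 'v \<Rightarrow> 'v) \<Rightarrow>
   ('v \<Rightarrow> 'v \<Rightarrow> 'v) \<Rightarrow> 'k \<Rightarrow> ('v \<Rightarrow> 'a) \<Rightarrow> bool" where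
  "relative_RB_operator s m sV V l \<rho> mV wt T \<longleftrightarrow>
     A_perm_algebra s m sV V l \<rho> mV \<and> linear_on sV V s UNIV T \<and>
     (\<forall>u\<in>V. \<forall>w\<in>V. m (T u) (T w) = T (l (T u) w + \<rho> (T w) u + sV wt (mV u w)))"


section \<open>Tensor products\<close>

text \<open>\<open>A \<otimes> A\<close> is the free vector space on \<^typ>\<open>'a \<times> 'a\<close> modulo the subspace \<open>null2\<close> spanned by the
  bilinearity relations, and \<open>A \<otimes> A \<otimes> A\<close> is the free vector space on \<^typ>\<open>'a \<times> 'a \<times> 'a\<close> modulo
  the trilinearity relations. Elements are handled through representatives: a tensor
  \<open>\<Sum>\<^sub>i a\<^sub>i \<otimes> b\<^sub>i\<close> is a formal combination of pairs, and equality in the tensor product is the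
  congruence \<open>teq2\<close> or \<open>teq3\<close>, never equality of formal combinations.\<close>

definition fscale :: "'k::field \<Rightarrow> ('x \<Rightarrow>\<^sub>0 'k) \<Rightarrow> ('x \<Rightarrow>\<^sub>0 'k)" where
  "fscale c t = Poly_Mapping.map ((*) c) t"

lemma lookup_fscale: "Poly_Mapping.lookup (fscale c t) x = c * Poly_Mapping.lookup t x"
  by (simp add: fscale_def Poly_Mapping.map.rep_eq when_def)

lemma vector_space_fscale: "vector_space (fscale :: 'k::field \<Rightarrow> ('x \<Rightarrow>\<^sub>0 'k) \<Rightarrow> _)"
  by unfold_locales (auto intro!: poly_mapping_eqI simp: lookup_fscale lookup_add algebra_simps)

definition pure2 :: "'a \<Rightarrow> 'a \<Rightarrow> ('a \<times> 'a) \<Rightarrow>\<^sub>0 'k::field" where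
  "pure2 a b = Poly_Mapping.single (a, b) 1"

definition pure3 :: "'a \<Rightarrow> 'a \<Rightarrow> 'a \<Rightarrow> ('a \<times> 'a \<times> 'a) \<Rightarrow>\<^sub>0 'k::field" where
  "pure3 a b c = Poly_Mapping.single (a, b, c) 1"

definition null2 :: "('k::field \<Rightarrow> 'a::ab_group_add \<Rightarrow> 'a) \<Rightarrow> (('a \<times> 'a) \<Rightarrow>\<^sub>0 'k) set" where
  "null2 s = module.span fscale
     ({pure2 (a + a') b - pure2 a b - pure2 a' b | a a' b. True} \<union>
      {pure2 a (b + b') - pure2 a b - pure2 a b' | a b b'. True} \<union>
      {pure2 (s k a) b - fscale k (pure2 a b) | k a b. True} \<union>
      {pure2 a (s k b) - fscale k (pure2 a b) | k a b. True})"

definition null3 :: "('k::field \<Rightarrow> 'a::ab_group_add \<Rightarrow> 'a) \<Rightarrow> (('a \<times> 'a \<times> 'a) \<Rightarrow>\<^sub>0 'k) set" where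
  "null3 s = module.span fscale
     ({pure3 (a + a') b c - pure3 a b c - pure3 a' b c | a a' b c. True} \<union>
      {pure3 a (b + b') c - pure3 a b c - pure3 a b' c | a b b' c. True} \<union>
      {pure3 a b (c + c') - pure3 a b c - pure3 a b c' | a b c c'. True} \<union>
      {pure3 (s k a) b c - fscale k (pure3 a b c) | k a b c. True} \<union>
      {pure3 a (s k b) c - fscale k (pure3 a b c) | k a b c. True} \<union>
      {pure3 a b (s k c) - fscale k (pure3 a b c) | k a b c. True})"

definition teq2 ::
  "('k::field \<Rightarrow> 'a::ab_group_add \<Rightarrow> 'a) \<Rightarrow> (('a \<times> 'a) \<Rightarrow>\<^sub>0 'k) \<Rightarrow> (('a \<times> 'a) \<Rightarrow>\<^sub>0 'k) \<Rightarrow> bool" where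
  "teq2 s t u \<longleftrightarrow> t - u \<in> null2 s"

definition teq3 ::
  "('k::field \<Rightarrow> 'a::ab_group_add \<Rightarrow> 'a) \<Rightarrow>
   (('a \<times> 'a \<times> 'a) \<Rightarrow>\<^sub>0 'k) \<Rightarrow> (('a \<times> 'a \<times> 'a) \<Rightarrow>\<^sub>0 'k) \<Rightarrow> bool" where
  "teq3 s t u \<longleftrightarrow> t - u \<in> null3 s"

text \<open>Linear extension \<open>\<Sum>\<^sub>i c\<^sub>i x\<^sub>i \<mapsto> \<Sum>\<^sub>i c\<^sub>i f(x\<^sub>i)\<close> from a free vector space.\<close>

definition lin_ext ::
  "('k::field \<Rightarrow> 'v::ab_group_add \<Rightarrow> 'v) \<Rightarrow> ('x \<Rightarrow> 'v) \<Rightarrow> ('x \<Rightarrow>\<^sub>0 'k) \<Rightarrow> 'v" where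
  "lin_ext sV f t = (\<Sum>x\<in>Poly_Mapping.keys t. sV (Poly_Mapping.lookup t x) (f x))"

definition tensor_map ::
  "('a \<Rightarrow> 'a) \<Rightarrow> ('a \<Rightarrow> 'a) \<Rightarrow> (('a \<times> 'a) \<Rightarrow>\<^sub>0 'k::field) \<Rightarrow> (('a \<times> 'a) \<Rightarrow>\<^sub>0 'k)" where
  "tensor_map f g = lin_ext fscale (\<lambda>(a, b). pure2 (f a) (g b))"

definition flip :: "(('a \<times> 'a) \<Rightarrow>\<^sub>0 'k::field) \<Rightarrow> (('a \<times> 'a) \<Rightarrow>\<^sub>0 'k)" where
  "flip = lin_ext fscale (\<lambda>(a, b). pure2 b a)"

text \<open>\<open>\<sigma> \<otimes> id\<close>, \<open>\<Delta> \<otimes> id\<close> and \<open>id \<otimes> \<Delta>\<close>.\<close>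

definition flip_id ::
  "(('a \<times> 'a \<times> 'a) \<Rightarrow>\<^sub>0 'k::field) \<Rightarrow> (('a \<times> 'a \<times> 'a) \<Rightarrow>\<^sub>0 'k)" where
  "flip_id = lin_ext fscale (\<lambda>(a, b, c). pure3 b a c)"

definition comult_id ::
  "('a \<Rightarrow> (('a \<times> 'a) \<Rightarrow>\<^sub>0 'k::field)) \<Rightarrow> (('a \<times> 'a) \<Rightarrow>\<^sub>0 'k) \<Rightarrow> (('a \<times> 'a \<times> 'a) \<Rightarrow>\<^sub>0 'k)" where
  "comult_id \<Delta> = lin_ext fscale (\<lambda>(a, b). lin_ext fscale (\<lambda>(u, v). pure3 u v b) (\<Delta> a))"

definition id_comult ::
  "('a \<Rightarrow> (('a \<times> 'a) \<Rightarrow>\<^sub>0 'k::field)) \<Rightarrow> (('a \<times> 'a) \<Rightarrow>\<^sub>0 'k) \<Rightarrow> (('a \<times> 'a \<times> 'a) \<Rightarrow>\<^sub>0 'k)" where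
  "id_comult \<Delta> = lin_ext fscale (\<lambda>(a, b). lin_ext fscale (\<lambda>(u, v). pure3 a u v) (\<Delta> b))"


section \<open>Perm coalgebras and perm bialgebras\<close>

definition perm_coalgebra ::
  "('k::field \<Rightarrow> 'a::ab_group_add \<Rightarrow> 'a) \<Rightarrow> ('a \<Rightarrow> (('a \<times> 'a) \<Rightarrow>\<^sub>0 'k)) \<Rightarrow> bool" where
  "perm_coalgebra s \<Delta> \<longleftrightarrow>
     fd_space s UNIV \<and>
     (\<forall>a b. teq2 s (\<Delta> (a + b)) (\<Delta> a + \<Delta> b)) \<and>
     (\<forall>k a. teq2 s (\<Delta> (s k a)) (fscale k (\<Delta> a))) \<and>
     (\<forall>a. teq3 s (comult_id \<Delta> (\<Delta> a)) (id_comult \<Delta> (\<Delta> a)) \<and>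
          teq3 s (id_comult \<Delta> (\<Delta> a)) (flip_id (comult_id \<Delta> (\<Delta> a))))"

definition perm_bialgebra ::
  "('k::field \<Rightarrow> 'a::ab_group_add \<Rightarrow> 'a) \<Rightarrow> ('a \<Rightarrow> 'a \<Rightarrow> 'a) \<Rightarrow>
   ('a \<Rightarrow> (('a \<times> 'a) \<Rightarrow>\<^sub>0 'k)) \<Rightarrow> bool" where
  "perm_bialgebra s m \<Delta> \<longleftrightarrow>
     perm_algebra s UNIV m \<and> perm_coalgebra s \<Delta> \<and>
     (\<forall>a b.
        teq2 s (\<Delta> (m a b))
               (tensor_map (ad m a) id (\<Delta> b) + tensor_map id (Rmul m b) (\<Delta> a)) \<and>
        teq2 s (flip (tensor_map (Rmul m b) id (\<Delta> a))) (tensor_map (Rmul m a) id (\<Delta> b)) \<and>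
        teq2 s (\<Delta> (m a b))
               (tensor_map id (Lmul m a) (\<Delta> b) +
                tensor_map (ad m b) id (\<Delta> a - flip (\<Delta> a))))"

definition T_map ::
  "('k::field \<Rightarrow> 'a::ab_group_add \<Rightarrow> 'a) \<Rightarrow> (('a \<times> 'a) \<Rightarrow>\<^sub>0 'k) \<Rightarrow> ('a \<Rightarrow> 'k) \<Rightarrow> 'a" where
  "T_map s r f = lin_ext s (\<lambda>(a, b). s (f a) b) r"

definition Delta_of ::
  "('a::ab_group_add \<Rightarrow> 'a \<Rightarrow> 'a) \<Rightarrow> (('a \<times> 'a) \<Rightarrow>\<^sub>0 'k::field) \<Rightarrow> 'a \<Rightarrow> (('a \<times> 'a) \<Rightarrow>\<^sub>0 'k)" where
  "Delta_of m r a = tensor_map id (Rmul m a) r - tensor_map (ad m a) id r"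

definition PYBE_solution ::
  "('k::field \<Rightarrow> 'a::ab_group_add \<Rightarrow> 'a) \<Rightarrow> ('a \<Rightarrow> 'a \<Rightarrow> 'a) \<Rightarrow> (('a \<times> 'a) \<Rightarrow>\<^sub>0 'k) \<Rightarrow> bool" where
  "PYBE_solution s m r \<longleftrightarrow>
     teq3 s
       (lin_ext fscale (\<lambda>(ai, bi). lin_ext fscale (\<lambda>(aj, bj).
            pure3 ai (m bi aj) bj - pure3 ai aj (m bi bj)
          + pure3 (m ai aj) bi bj - pure3 (m aj ai) bi bj) r) r)
       0"

definition R_ad_invariant ::
  "('k::field \<Rightarrow> 'a::ab_group_add \<Rightarrow> 'a) \<Rightarrow> ('a \<Rightarrow> 'a \<Rightarrow> 'a) \<Rightarrow> (('a \<times> 'a) \<Rightarrow>\<^sub>0 'k) \<Rightarrow> bool" where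
  "R_ad_invariant s m t \<longleftrightarrow>
     (\<forall>a. teq2 s (tensor_map id (Rmul m a) t - tensor_map (ad m a) id t) 0)"

definition skew_part :: "(('a \<times> 'a) \<Rightarrow>\<^sub>0 'k::field) \<Rightarrow> (('a \<times> 'a) \<Rightarrow>\<^sub>0 'k)" where
  "skew_part r = fscale (1/2) (r - flip r)"

definition quasi_triangular ::
  "('k::field \<Rightarrow> 'a::ab_group_add \<Rightarrow> 'a) \<Rightarrow> ('a \<Rightarrow> 'a \<Rightarrow> 'a) \<Rightarrow> (('a \<times> 'a) \<Rightarrow>\<^sub>0 'k) \<Rightarrow> bool" where
  "quasi_triangular s m r \<longleftrightarrow>
     perm_bialgebra s m (Delta_of m r) \<and> PYBE_solution s m r \<and>
     R_ad_invariant s m (skew_part r)"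

text \<open>The product \<open>a\<^sup>* \<diamond>\<^sub>t b\<^sup>* = L\<^sup>*(T\<^sub>t(a\<^sup>*)) b\<^sup>*\<close> on the dual space.\<close>

definition diamond ::
  "('k::field \<Rightarrow> 'a::ab_group_add \<Rightarrow> 'a) \<Rightarrow> ('a \<Rightarrow> 'a \<Rightarrow> 'a) \<Rightarrow> (('a \<times> 'a) \<Rightarrow>\<^sub>0 'k) \<Rightarrow>
   ('a \<Rightarrow> 'k) \<Rightarrow> ('a \<Rightarrow> 'k) \<Rightarrow> 'a \<Rightarrow> 'k" where
  "diamond s m t f g = dual_map (Lmul m) (T_map s t f) g"

end

theory Submission
  imports Defs
begin

text \<open>In finite dimension a tensor vanishes iff all its pairings with functionals vanish, so every
  condition can be read on the dual space. Write \<open>T = T\<^sub>r\<close>, let \<open>T' = T\<^sub>t\<close> with \<open>t = \<sigma>(r)\<close> be its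
  transpose, and \<open>S = T - T'\<close>. The coproduct \<open>\<Delta>\<^sub>r\<close> is dual to the product
  \<open>f * g = L\<^sup>*(T f) g + ad\<^sup>*(T' g) f\<close>, and the perm Yang-Baxter equation says
  \<open>T (f * g) = T f \<cdot> T g\<close>. Invariance of the skew part gives \<open>L\<^sup>*(S f) g = ad\<^sup>*(S g) f\<close>, so
  \<open>f * g = L\<^sup>*(T f) g + ad\<^sup>*(T g) f - f \<diamond> g\<close>, and the Yang-Baxter equation is the
  Rota-Baxter equation. Invariance also gives \<open>S (f \<circ> L(a)) = a \<cdot> S f\<close> and \<open>S (f \<circ> ad(a)) = S f \<cdot> a\<close>;
  hence \<open>T'\<close> is multiplicative together with \<open>T\<close>, which makes \<open>*\<close> a perm product.\<close>

section \<open>Pairing tensors with functionals\<close>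

text \<open>Proves an identity modulo a known one: it remains to check formally that the two
  differences of sides agree.\<close>

lemma eq_from_diff_eq:
  fixes a b c d :: "'a::ab_group_add"
  shows "a - b = c - d \<Longrightarrow> c = d \<Longrightarrow> a = b"
  by simp

lemma vector_space_dscale:
  "vector_space (dscale :: 'k::field \<Rightarrow> ('a \<Rightarrow> 'k) \<Rightarrow> _)"
  by unfold_locales (auto simp: dscale_def fun_eq_iff algebra_simps)

lemma vector_space_mult: "vector_space ((*) :: 'k::field \<Rightarrow> _)"
  by unfold_locales (auto simp: algebra_simps)

lemma dual_iff:
  assumes "vector_space s"
  shows "f \<in> dual s \<longleftrightarrow> (\<forall>x y. f (x + y) = f x + f y) \<and> (\<forall>c x. f (s c x) = c * f x)"
  unfolding dual_def Vector_Spaces.linear_iff using assms vector_space_mult by auto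

section \<open>Linear extension from a free vector space\<close>

lemma lin_ext_superset:
  assumes "vector_space sV" "finite X" "Poly_Mapping.keys t \<subseteq> X"
  shows "lin_ext sV f t = (\<Sum>x\<in>X. sV (Poly_Mapping.lookup t x) (f x))"
proof -
  interpret vector_space sV by fact
  show ?thesis
    unfolding lin_ext_def using assms
    by (intro sum.mono_neutral_left) (auto simp: in_keys_iff)
qed

lemma linear_lin_ext:
  assumes "vector_space sV"
  shows "Vector_Spaces.linear fscale sV (lin_ext sV f)"
proof -
  interpret vector_space sV by fact
  have "lin_ext sV f (t + u) = lin_ext sV f t + lin_ext sV f u" for t u
  proof -
    let ?X = "Poly_Mapping.keys t \<union> Poly_Mapping.keys u"
    have "Poly_Mapping.keys (t + u) \<subseteq> ?X"
      by (rule keys_add)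
    then show ?thesis
      by (simp add: lin_ext_superset[OF assms, of ?X] lookup_add scale_left_distrib sum.distrib)
  qed
  moreover have "lin_ext sV f (fscale c t) = sV c (lin_ext sV f t)" for c t
  proof -
    have "Poly_Mapping.keys (fscale c t) \<subseteq> Poly_Mapping.keys t"
      by (auto simp: in_keys_iff lookup_fscale)
    then show ?thesis
      by (simp add: lin_ext_superset[OF assms, of "Poly_Mapping.keys t"] lookup_fscale scale_sum_right)
  qed
  ultimately show ?thesis
    unfolding Vector_Spaces.linear_iff using assms vector_space_fscale by blast
qed

lemma lin_ext_compose:
  assumes "Vector_Spaces.linear sV sW \<phi>"
  shows "\<phi> (lin_ext sV f t) = lin_ext sW (\<lambda>x. \<phi> (f x)) t"
proof -
  interpret Vector_Spaces.linear sV sW \<phi> by fact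
  show ?thesis
    unfolding lin_ext_def by (simp add: sum scale)
qed

lemma lin_ext_add_fun:
  "vector_space sV \<Longrightarrow> lin_ext sV (\<lambda>x. f x + g x) t = lin_ext sV f t + lin_ext sV g t"
  unfolding lin_ext_def by (simp add: vector_space.vector_space_assms sum.distrib)

lemma lin_ext_scale_fun:
  assumes "vector_space sV"
  shows "lin_ext sV (\<lambda>x. sV c (f x)) t = sV c (lin_ext sV f t)"
proof -
  interpret vector_space sV by fact
  show ?thesis
    unfolding lin_ext_def scale_sum_right by (simp add: mult.commute)
qed

lemma lin_ext_single:
  assumes "vector_space sV"
  shows "lin_ext sV f (Poly_Mapping.single x 1) = f x"
  using assms by (simp add: lin_ext_def vector_space.vector_space_assms)

text \<open>Expansion in the basis of the free space; it lets a linear map be checked on pure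
  tensors only.\<close>

lemma lin_ext_singles: "lin_ext fscale (\<lambda>x. Poly_Mapping.single x 1) t = t"
proof (rule poly_mapping_eqI)
  fix y
  show "Poly_Mapping.lookup (lin_ext fscale (\<lambda>x. Poly_Mapping.single x 1) t) y = Poly_Mapping.lookup t y"
    unfolding lin_ext_def
    by (simp add: lookup_sum lookup_fscale lookup_single when_def in_keys_iff if_distrib[of "(*) _"] cong: if_cong)
qed

text \<open>This is the functional \<open>f \<otimes> g\<close> on representatives. It respects
  \<open>teq2\<close> once \<open>f\<close> and \<open>g\<close> lie in the dual space.\<close>

definition pair2 :: "('a \<Rightarrow> 'k) \<Rightarrow> ('a \<Rightarrow> 'k) \<Rightarrow> (('a \<times> 'a) \<Rightarrow>\<^sub>0 'k::field) \<Rightarrow> 'k" where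
  "pair2 f g = lin_ext (*) (\<lambda>(a, b). f a * g b)"

definition pair3 ::
  "('a \<Rightarrow> 'k) \<Rightarrow> ('a \<Rightarrow> 'k) \<Rightarrow> ('a \<Rightarrow> 'k) \<Rightarrow> (('a \<times> 'a \<times> 'a) \<Rightarrow>\<^sub>0 'k::field) \<Rightarrow> 'k" where
  "pair3 f g h = lin_ext (*) (\<lambda>(a, b, c). f a * g b * h c)"

lemma linear_pair2: "Vector_Spaces.linear fscale (*) (pair2 f g)"
  unfolding pair2_def by (rule linear_lin_ext[OF vector_space_mult])

lemma linear_pair3: "Vector_Spaces.linear fscale (*) (pair3 f g h)"
  unfolding pair3_def by (rule linear_lin_ext[OF vector_space_mult])

lemma pair2_pure2: "pair2 f g (pure2 a b) = f a * g b"
  unfolding pair2_def pure2_def by (simp add: lin_ext_single[OF vector_space_mult])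

lemma pair3_pure3: "pair3 f g h (pure3 a b c) = f a * g b * h c"
  unfolding pair3_def pure3_def by (simp add: lin_ext_single[OF vector_space_mult])

lemmas pair2_linear_simps =
  module_hom.add[OF linear_pair2[unfolded Vector_Spaces.linear_iff_module_hom]]
  module_hom.diff[OF linear_pair2[unfolded Vector_Spaces.linear_iff_module_hom]]
  module_hom.scale[OF linear_pair2[unfolded Vector_Spaces.linear_iff_module_hom]]
  module_hom.zero[OF linear_pair2[unfolded Vector_Spaces.linear_iff_module_hom]]

lemmas pair3_linear_simps =
  module_hom.add[OF linear_pair3[unfolded Vector_Spaces.linear_iff_module_hom]]
  module_hom.diff[OF linear_pair3[unfolded Vector_Spaces.linear_iff_module_hom]]
  module_hom.scale[OF linear_pair3[unfolded Vector_Spaces.linear_iff_module_hom]]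
  module_hom.zero[OF linear_pair3[unfolded Vector_Spaces.linear_iff_module_hom]]

section \<open>Transposes of the operations on tensors\<close>

lemma pair2_flip: "pair2 f g (flip t) = pair2 g f t"
proof -
  have "pair2 f g (flip t) = lin_ext (*) (\<lambda>x. pair2 f g (case x of (a, b) \<Rightarrow> pure2 b a)) t"
    unfolding flip_def by (rule lin_ext_compose[OF linear_pair2])
  also have "\<dots> = pair2 g f t"
    unfolding pair2_def[of g f]
    by (intro arg_cong[where f = "\<lambda>F. lin_ext (*) F t"]) (auto simp: pair2_pure2 mult.commute)
  finally show ?thesis .
qed

lemma pair2_tensor_map:
  "pair2 f g (tensor_map \<phi> \<psi> t) = pair2 (\<lambda>x. f (\<phi> x)) (\<lambda>x. g (\<psi> x)) t"
proof -
  have "pair2 f g (tensor_map \<phi> \<psi> t) =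
      lin_ext (*) (\<lambda>x. pair2 f g (case x of (a, b) \<Rightarrow> pure2 (\<phi> a) (\<psi> b))) t"
    unfolding tensor_map_def by (rule lin_ext_compose[OF linear_pair2])
  also have "\<dots> = pair2 (\<lambda>x. f (\<phi> x)) (\<lambda>x. g (\<psi> x)) t"
    unfolding pair2_def[of "\<lambda>x. f (\<phi> x)"]
    by (intro arg_cong[where f = "\<lambda>F. lin_ext (*) F t"]) (auto simp: pair2_pure2)
  finally show ?thesis .
qed

lemma pair3_flip_id: "pair3 f g h (flip_id t) = pair3 g f h t"
proof -
  have "pair3 f g h (flip_id t) = lin_ext (*) (\<lambda>x. pair3 f g h (case x of (a, b, c) \<Rightarrow> pure3 b a c)) t"
    unfolding flip_id_def by (rule lin_ext_compose[OF linear_pair3])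
  also have "\<dots> = pair3 g f h t"
    unfolding pair3_def[of g f h]
    by (intro arg_cong[where f = "\<lambda>F. lin_ext (*) F t"]) (auto simp: pair3_pure3)
  finally show ?thesis .
qed

text \<open>If a product on functionals is transposed to \<open>\<Delta>\<close>, then
  \<open>\<Delta> \<otimes> id\<close> is transposed to multiplying the first two of three
  functionals. Coassociativity thereby becomes associativity.\<close>

lemma pair3_comult_id:
  "pair3 f g h (comult_id \<Delta> t) = pair2 (\<lambda>a. pair2 f g (\<Delta> a)) h t"
proof -
  have inner: "pair3 f g h (lin_ext fscale (\<lambda>(u, v). pure3 u v b) w) = pair2 f g w * h b" for b w
  proof -
    have "pair3 f g h (lin_ext fscale (\<lambda>(u, v). pure3 u v b) w) =
        lin_ext (*) (\<lambda>x. h b * (case x of (u, v) \<Rightarrow> f u * g v)) w"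
      unfolding lin_ext_compose[OF linear_pair3]
      by (intro arg_cong[where f = "\<lambda>F. lin_ext (*) F w"]) (auto simp: pair3_pure3)
    then show ?thesis
      by (simp add: lin_ext_scale_fun[OF vector_space_mult] pair2_def)
  qed
  show ?thesis
    unfolding comult_id_def lin_ext_compose[OF linear_pair3] pair2_def[of "\<lambda>a. pair2 f g (\<Delta> a)"]
    by (intro arg_cong[where f = "\<lambda>F. lin_ext (*) F t"]) (auto simp: inner)
qed

lemma pair3_id_comult:
  "pair3 f g h (id_comult \<Delta> t) = pair2 f (\<lambda>a. pair2 g h (\<Delta> a)) t"
proof -
  have inner: "pair3 f g h (lin_ext fscale (\<lambda>(u, v). pure3 a u v) w) = f a * pair2 g h w" for a w
  proof -
    have "pair3 f g h (lin_ext fscale (\<lambda>(u, v). pure3 a u v) w) =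
        lin_ext (*) (\<lambda>x. f a * (case x of (u, v) \<Rightarrow> g u * h v)) w"
      unfolding lin_ext_compose[OF linear_pair3]
      by (intro arg_cong[where f = "\<lambda>F. lin_ext (*) F w"]) (auto simp: pair3_pure3)
    then show ?thesis
      by (simp add: lin_ext_scale_fun[OF vector_space_mult] pair2_def)
  qed
  show ?thesis
    unfolding id_comult_def lin_ext_compose[OF linear_pair3] pair2_def[of f]
    by (intro arg_cong[where f = "\<lambda>F. lin_ext (*) F t"]) (auto simp: inner)
qed

section \<open>Coordinates and the detection of zero tensors\<close>

lemma fd_space_coordinates:
  assumes "fd_space s UNIV"
  obtains B e where "finite B" "\<And>b. e b \<in> dual s" "\<And>x. (\<Sum>b\<in>B. s (e b x) b) = x"
proof -
  interpret vector_space s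
    using assms by (simp add: fd_space_def)
  obtain C where C: "finite C" "span C = UNIV"
    using assms by (auto simp: fd_space_def)
  obtain B where B: "B \<subseteq> C" "independent B" "C \<subseteq> span B"
    using maximal_independent_subset[of C] .
  have fin: "finite B"
    using B(1) C(1) by (rule finite_subset)
  have sp: "span B = UNIV"
    using span_minimal[OF B(3) subspace_span] C(2) by auto
  show ?thesis
  proof
    show "finite B" by (rule fin)
    show "(\<lambda>x. representation B x b) \<in> dual s" for b
      unfolding dual_def using linear_representation[OF B(2) sp] by simp
    show "(\<Sum>b\<in>B. s (representation B x b) b) = x" for x
      using sum_representation_eq[OF B(2), of x B] sp fin by simp
  qed
qed

text \<open>Meant for \<open>pure2\<close> and \<open>pure3\<close> as functions of one slot: on
  representatives they are linear only modulo the null subspace.\<close>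

lemma linear_mod_subspace_sum:
  assumes N: "module.subspace fscale N"
    and add: "\<And>x y. F (x + y) - F x - F y \<in> N"
    and scl: "\<And>k x. F (s k x) - fscale k (F x) \<in> N"
    and s: "vector_space s" and fin: "finite I"
  shows "F (\<Sum>i\<in>I. s (k i) (x i)) - (\<Sum>i\<in>I. fscale (k i) (F (x i))) \<in> N"
proof -
  interpret S: vector_space s by fact
  interpret W: vector_space "fscale :: 'a \<Rightarrow> ('b \<Rightarrow>\<^sub>0 'a) \<Rightarrow> _"
    by (rule vector_space_fscale)
  show ?thesis
    using fin
  proof (induction I)
    case empty
    have "F 0 \<in> N"
      using scl[of 0 0] by simp
    then show ?case by simp
  next
    case (insert i I)
    have "F (s (k i) (x i) + (\<Sum>i\<in>I. s (k i) (x i))) - F (s (k i) (x i)) - F (\<Sum>i\<in>I. s (k i) (x i))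
        + ((F (s (k i) (x i)) - fscale (k i) (F (x i)))
        + (F (\<Sum>i\<in>I. s (k i) (x i)) - (\<Sum>i\<in>I. fscale (k i) (F (x i))))) \<in> N"
      by (intro W.subspace_add[OF N] add scl insert.IH)
    then show ?case
      using insert.hyps by (simp add: algebra_simps)
  qed
qed

lemma fscale_fscale: "fscale a (fscale b t) = fscale (a * b) t"
  by (rule poly_mapping_eqI) (simp add: lookup_fscale mult.assoc)

text \<open>Pairings with linear functionals kill the generating relations. Conversely, modulo
  \<open>null2\<close> a tensor equals its coordinate expansion, whose coefficients are
  pairings.\<close>

lemma null2_iff:
  fixes s :: "'k::field \<Rightarrow> 'a::ab_group_add \<Rightarrow> 'a"
  assumes fd: "fd_space s UNIV"
  shows "t \<in> null2 s \<longleftrightarrow> (\<forall>f\<in>dual s. \<forall>g\<in>dual s. pair2 f g t = 0)"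
proof
  interpret S: vector_space s
    using fd by (simp add: fd_space_def)
  interpret W: vector_space "fscale :: 'k \<Rightarrow> (('a \<times> 'a) \<Rightarrow>\<^sub>0 'k) \<Rightarrow> _"
    by (rule vector_space_fscale)
  {
    assume t: "t \<in> null2 s"
    show "\<forall>f\<in>dual s. \<forall>g\<in>dual s. pair2 f g t = 0"
    proof (intro ballI)
      fix f g assume f: "f \<in> dual s" and g: "g \<in> dual s"
      show "pair2 f g t = 0"
        using t f g unfolding null2_def dual_iff[OF S.vector_space_axioms]
        by (induction rule: W.span_induct_alt)
           (auto simp: pair2_linear_simps pair2_pure2 ring_distribs mult_ac)
    qed
  }
  assume z: "\<forall>f\<in>dual s. \<forall>g\<in>dual s. pair2 f g t = 0"
  obtain B e where B: "finite B" "\<And>b. e b \<in> dual s" "\<And>x. (\<Sum>b\<in>B. s (e b x) b) = x"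
    using fd_space_coordinates[OF fd] by blast
  \<comment> \<open>\<open>red u\<close> is the tensor minus its coordinate expansion. It always
    lies in \<open>null2 s\<close>, and it equals \<open>u\<close> when all pairings of
    \<open>u\<close> vanish.\<close>
  define red :: "(('a \<times> 'a) \<Rightarrow>\<^sub>0 'k) \<Rightarrow> (('a \<times> 'a) \<Rightarrow>\<^sub>0 'k)" where
    "red u = u - (\<Sum>b\<in>B. \<Sum>c\<in>B. fscale (pair2 (e b) (e c) u) (pure2 b c))" for u
  have N: "W.subspace (null2 s)"
    unfolding null2_def by (rule W.subspace_span)
  have lin: "Vector_Spaces.linear fscale fscale red"
    unfolding Vector_Spaces.linear_iff red_def using vector_space_fscale
    by (auto simp: pair2_linear_simps W.scale_left_distrib sum.distrib W.scale_sum_right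
        W.scale_right_diff_distrib)
  have left: "pure2 (\<Sum>b\<in>B. s (e b x) b) y - (\<Sum>b\<in>B. fscale (e b x) (pure2 b y)) \<in> null2 s" for x y
    by (rule linear_mod_subspace_sum[OF N _ _ S.vector_space_axioms B(1), of "\<lambda>x. pure2 x y"])
       (unfold null2_def, (rule W.span_base, blast)+)
  have right: "pure2 b (\<Sum>c\<in>B. s (e c y) c) - (\<Sum>c\<in>B. fscale (e c y) (pure2 b c)) \<in> null2 s" for b y
    by (rule linear_mod_subspace_sum[OF N _ _ S.vector_space_axioms B(1), of "pure2 b"])
       (unfold null2_def, (rule W.span_base, blast)+)
  have pure: "red (pure2 x y) \<in> null2 s" for x y
  proof -
    \<comment> \<open>Expand the left factor first, then the right factor in each resulting term;
      the intermediate sums cancel.\<close>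
    have "(pure2 x y - (\<Sum>b\<in>B. fscale (e b x) (pure2 b y)))
        + (\<Sum>b\<in>B. fscale (e b x) (pure2 b y - (\<Sum>c\<in>B. fscale (e c y) (pure2 b c)))) \<in> null2 s"
      using left[of x y] right[of _ y]
      by (intro W.subspace_add[OF N] W.subspace_sum[OF N] W.subspace_scale[OF N]) (simp_all add: B(3))
    then show ?thesis
      unfolding red_def
      by (simp add: pair2_pure2 W.scale_right_diff_distrib sum_subtractf W.scale_sum_right fscale_fscale)
  qed
  have "red t = lin_ext fscale (\<lambda>x. red (Poly_Mapping.single x 1)) t"
    using lin_ext_compose[OF lin, of "\<lambda>x. Poly_Mapping.single x 1" t] by (simp add: lin_ext_singles)
  also have "\<dots> \<in> null2 s"
    unfolding lin_ext_def
  proof (intro W.subspace_sum[OF N] W.subspace_scale[OF N])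
    fix x :: "'a \<times> 'a"
    show "red (Poly_Mapping.single x 1) \<in> null2 s"
      using pure[of "fst x" "snd x"] by (simp add: pure2_def)
  qed
  finally show "t \<in> null2 s"
    using z B(2) by (simp add: red_def)
qed

text \<open>The argument of \<open>null2_iff\<close>, with the three slots expanded one after
  another.\<close>

lemma null3_iff:
  fixes s :: "'k::field \<Rightarrow> 'a::ab_group_add \<Rightarrow> 'a"
  assumes fd: "fd_space s UNIV"
  shows "t \<in> null3 s \<longleftrightarrow> (\<forall>f\<in>dual s. \<forall>g\<in>dual s. \<forall>h\<in>dual s. pair3 f g h t = 0)"
proof
  interpret S: vector_space s
    using fd by (simp add: fd_space_def)
  interpret W: vector_space "fscale :: 'k \<Rightarrow> (('a \<times> 'a \<times> 'a) \<Rightarrow>\<^sub>0 'k) \<Rightarrow> _"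
    by (rule vector_space_fscale)
  {
    assume t: "t \<in> null3 s"
    show "\<forall>f\<in>dual s. \<forall>g\<in>dual s. \<forall>h\<in>dual s. pair3 f g h t = 0"
    proof (intro ballI)
      fix f g h assume f: "f \<in> dual s" and g: "g \<in> dual s" and h: "h \<in> dual s"
      show "pair3 f g h t = 0"
        using t f g h unfolding null3_def dual_iff[OF S.vector_space_axioms]
        by (induction rule: W.span_induct_alt)
           (auto simp: pair3_linear_simps pair3_pure3 ring_distribs mult_ac)
    qed
  }
  assume z: "\<forall>f\<in>dual s. \<forall>g\<in>dual s. \<forall>h\<in>dual s. pair3 f g h t = 0"
  obtain B e where B: "finite B" "\<And>b. e b \<in> dual s" "\<And>x. (\<Sum>b\<in>B. s (e b x) b) = x"
    using fd_space_coordinates[OF fd] by blast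
  define red :: "(('a \<times> 'a \<times> 'a) \<Rightarrow>\<^sub>0 'k) \<Rightarrow> (('a \<times> 'a \<times> 'a) \<Rightarrow>\<^sub>0 'k)" where
    "red u = u - (\<Sum>b\<in>B. \<Sum>c\<in>B. \<Sum>d\<in>B. fscale (pair3 (e b) (e c) (e d) u) (pure3 b c d))" for u
  have N: "W.subspace (null3 s)"
    unfolding null3_def by (rule W.subspace_span)
  have lin: "Vector_Spaces.linear fscale fscale red"
    unfolding Vector_Spaces.linear_iff red_def using vector_space_fscale
    by (auto simp: pair3_linear_simps W.scale_left_distrib sum.distrib W.scale_sum_right
        W.scale_right_diff_distrib)
  have first: "pure3 (\<Sum>b\<in>B. s (e b x) b) y w - (\<Sum>b\<in>B. fscale (e b x) (pure3 b y w)) \<in> null3 s" for x y w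
    by (rule linear_mod_subspace_sum[OF N _ _ S.vector_space_axioms B(1), of "\<lambda>x. pure3 x y w"])
       (unfold null3_def, (rule W.span_base, fast)+)
  have second: "pure3 b (\<Sum>c\<in>B. s (e c y) c) w - (\<Sum>c\<in>B. fscale (e c y) (pure3 b c w)) \<in> null3 s" for b y w
    by (rule linear_mod_subspace_sum[OF N _ _ S.vector_space_axioms B(1), of "\<lambda>y. pure3 b y w"])
       (unfold null3_def, (rule W.span_base, fast)+)
  have third: "pure3 b c (\<Sum>d\<in>B. s (e d w) d) - (\<Sum>d\<in>B. fscale (e d w) (pure3 b c d)) \<in> null3 s" for b c w
    by (rule linear_mod_subspace_sum[OF N _ _ S.vector_space_axioms B(1), of "pure3 b c"])
       (unfold null3_def, (rule W.span_base, fast)+)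
  have pure: "red (pure3 x y w) \<in> null3 s" for x y w
  proof -
    have "(pure3 x y w - (\<Sum>b\<in>B. fscale (e b x) (pure3 b y w)))
        + ((\<Sum>b\<in>B. fscale (e b x) (pure3 b y w - (\<Sum>c\<in>B. fscale (e c y) (pure3 b c w))))
        + (\<Sum>b\<in>B. fscale (e b x) (\<Sum>c\<in>B. fscale (e c y)
              (pure3 b c w - (\<Sum>d\<in>B. fscale (e d w) (pure3 b c d)))))) \<in> null3 s"
      using first[of x y w] second[of _ y w] third[of _ _ w]
      by (intro W.subspace_add[OF N] W.subspace_sum[OF N] W.subspace_scale[OF N]) (simp_all add: B(3))
    then show ?thesis
      unfolding red_def
      by (simp add: pair3_pure3 W.scale_right_diff_distrib sum_subtractf W.scale_sum_right
          fscale_fscale mult.assoc)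
  qed
  have "red t = lin_ext fscale (\<lambda>x. red (Poly_Mapping.single x 1)) t"
    using lin_ext_compose[OF lin, of "\<lambda>x. Poly_Mapping.single x 1" t] by (simp add: lin_ext_singles)
  also have "\<dots> \<in> null3 s"
    unfolding lin_ext_def
  proof (intro W.subspace_sum[OF N] W.subspace_scale[OF N])
    fix x :: "'a \<times> 'a \<times> 'a"
    show "red (Poly_Mapping.single x 1) \<in> null3 s"
      using pure[of "fst x" "fst (snd x)" "snd (snd x)"] by (simp add: pure3_def)
  qed
  finally show "t \<in> null3 s"
    using z B(2) by (simp add: red_def)
qed

text \<open>The coordinate functionals span the dual space: \<open>f\<close> is the combination of
  the \<open>e b\<close> with coefficients \<open>f b\<close>.\<close>

lemma fd_space_dual:
  assumes fd: "fd_space s UNIV"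
  shows "fd_space dscale (dual s)"
proof -
  interpret S: vector_space s
    using fd by (simp add: fd_space_def)
  interpret D: vector_space "dscale :: 'a \<Rightarrow> ('b \<Rightarrow> 'a) \<Rightarrow> _"
    by (rule vector_space_dscale)
  obtain B e where B: "finite B" "\<And>b. e b \<in> dual s" "\<And>x. (\<Sum>b\<in>B. s (e b x) b) = x"
    using fd_space_coordinates[OF fd] by blast
  have sub: "D.subspace (dual s)"
    by (rule D.subspaceI) (auto simp: dual_iff[OF S.vector_space_axioms] dscale_def algebra_simps)
  have "f \<in> D.span (e ` B)" if "f \<in> dual s" for f
  proof -
    interpret F: Vector_Spaces.linear s "(*)" f
      using that by (simp add: dual_def)
    have "f = (\<Sum>b\<in>B. dscale (f b) (e b))"
    proof
      fix x
      have "f x = f (\<Sum>b\<in>B. s (e b x) b)"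
        by (simp add: B(3))
      also have "\<dots> = (\<Sum>b\<in>B. dscale (f b) (e b) x)"
        by (simp add: F.sum F.scale dscale_def mult.commute)
      also have "\<dots> = (\<Sum>b\<in>B. dscale (f b) (e b)) x"
        using B(1) by (induction B) auto
      finally show "f x = (\<Sum>b\<in>B. dscale (f b) (e b)) x" .
    qed
    then show ?thesis
      by (metis (no_types, lifting) D.span_sum D.span_scale D.span_base imageI)
  qed
  then have "dual s = D.span (e ` B)"
    using D.span_minimal[OF _ sub, of "e ` B"] B(2) by auto
  then show ?thesis
    unfolding fd_space_def using vector_space_dscale B(1) by blast
qed


section \<open>Perm algebras with a 2-tensor\<close>

locale perm_with_tensor =
  fixes s :: "'k::field_char_0 \<Rightarrow> 'a::ab_group_add \<Rightarrow> 'a"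
    and m :: "'a \<Rightarrow> 'a \<Rightarrow> 'a"
    and r :: "('a \<times> 'a) \<Rightarrow>\<^sub>0 'k"
  assumes perm: "perm_algebra s UNIV m"
begin

abbreviation "T f \<equiv> T_map s r f"
abbreviation "T' f \<equiv> T_map s (flip r) f"
abbreviation "S f \<equiv> T f - T' f"

text \<open>The product on the dual space that is transposed to the coproduct \<open>\<Delta>\<^sub>r\<close>.\<close>

definition star :: "('a \<Rightarrow> 'k) \<Rightarrow> ('a \<Rightarrow> 'k) \<Rightarrow> 'a \<Rightarrow> 'k" where
  "star f g a = pair2 f g (Delta_of m r a)"

section \<open>Calculation rules for the product and for functionals\<close>

lemma fd: "fd_space s UNIV"
  using perm by (simp add: perm_algebra_def)

sublocale vector_space s
  using fd by (simp add: fd_space_def)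

lemma m_add: "m (x + y) z = m x z + m y z" "m z (x + y) = m z x + m z y"
  and m_scale: "m (s c x) z = s c (m x z)" "m z (s c x) = s c (m z x)"
  using perm by (auto simp: perm_algebra_def bilinear_on_def linear_on_def)

lemma m_diff: "m (x - y) z = m x z - m y z" "m z (x - y) = m z x - m z y"
  using m_add(1)[of "x - y" y z] m_add(2)[of z "x - y" y] by (simp_all add: algebra_simps)

lemma m_assoc: "m (m a b) c = m a (m b c)"
  and m_left_commute: "m a (m b c) = m b (m a c)"
  using perm by (auto simp: perm_algebra_def)

lemmas m_simps = m_add m_diff m_scale m_assoc m_left_commute

lemma ad_apply: "ad m a b = m a b - m b a"
  by (simp add: ad_def Lmul_def Rmul_def)

lemmas in_dual_iff = dual_iff[OF vector_space_axioms]

lemma dual_add: "f \<in> dual s \<Longrightarrow> f (x + y) = f x + f y"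
  and dual_scale: "f \<in> dual s \<Longrightarrow> f (s c x) = c * f x"
  by (simp_all add: in_dual_iff)

lemma dual_diff: "f \<in> dual s \<Longrightarrow> f (x - y) = f x - f y"
  using dual_add[of f "x - y" y] by (simp add: algebra_simps)

lemma dual_zero: "f \<in> dual s \<Longrightarrow> f 0 = 0"
  using dual_add[of f 0 0] by simp

lemmas dual_simps = dual_add dual_diff dual_scale dual_zero

lemma dual_L: "f \<in> dual s \<Longrightarrow> (\<lambda>x. f (m a x)) \<in> dual s"
  and dual_R: "f \<in> dual s \<Longrightarrow> (\<lambda>x. f (m x a)) \<in> dual s"
  and dual_ad: "f \<in> dual s \<Longrightarrow> (\<lambda>x. f (m a x - m x a)) \<in> dual s"
  by (auto simp: in_dual_iff m_add m_scale scale_right_diff_distrib[symmetric] dual_diff algebra_simps)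

text \<open>The form that \<open>dual_ad\<close> takes after simplification with
  \<open>dual_diff\<close>.\<close>

lemma dual_ad_expanded: "f \<in> dual s \<Longrightarrow> (\<lambda>x. f (m a x) - f (m x a)) \<in> dual s"
  using dual_ad[of f a] by (simp add: dual_diff)

lemma dual_sum: "f \<in> dual s \<Longrightarrow> g \<in> dual s \<Longrightarrow> (\<lambda>x. f x + g x) \<in> dual s"
  by (auto simp: in_dual_iff algebra_simps)

lemma dual_separates:
  assumes "\<And>f. f \<in> dual s \<Longrightarrow> f x = f y"
  shows "x = y"
proof -
  obtain B e where B: "finite B" "\<And>b. e b \<in> dual s" "\<And>x. (\<Sum>b\<in>B. s (e b x) b) = x"
    using fd_space_coordinates[OF fd] by blast
  have "(\<Sum>b\<in>B. s (e b x) b) = (\<Sum>b\<in>B. s (e b y) b)"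
    by (simp only: assms[OF B(2)])
  then show ?thesis
    by (simp only: B(3))
qed

section \<open>The maps \<open>T\<close> and \<open>T'\<close> and their adjointness\<close>

lemma T_map_add: "T_map s t (\<lambda>x. f x + g x) = T_map s t f + T_map s t g"
proof -
  have "T_map s t (\<lambda>x. f x + g x) = lin_ext s (\<lambda>x. (\<lambda>(a, b). s (f a) b) x + (\<lambda>(a, b). s (g a) b) x) t"
    unfolding T_map_def
    by (intro arg_cong[where f = "\<lambda>F. lin_ext s F t"]) (auto simp: scale_left_distrib)
  then show ?thesis
    unfolding T_map_def lin_ext_add_fun[OF vector_space_axioms] .
qed

lemma T_map_scale: "T_map s t (\<lambda>x. c * f x) = s c (T_map s t f)"
proof -
  have "T_map s t (\<lambda>x. c * f x) = lin_ext s (\<lambda>x. s c ((\<lambda>(a, b). s (f a) b) x)) t"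
    unfolding T_map_def
    by (intro arg_cong[where f = "\<lambda>F. lin_ext s F t"]) auto
  then show ?thesis
    unfolding T_map_def lin_ext_scale_fun[OF vector_space_axioms] .
qed

lemma T_map_diff: "T_map s t (\<lambda>x. f x - g x) = T_map s t f - T_map s t g"
  using T_map_add[of t "\<lambda>x. f x - g x" g] by (simp add: algebra_simps)

lemma T_map_skew: "T_map s (r - flip r) f = S f"
  unfolding T_map_def
  by (rule module_hom.diff[OF linear_lin_ext[OF vector_space_axioms, unfolded Vector_Spaces.linear_iff_module_hom]])

lemma pair2_T_map:
  assumes "g \<in> dual s"
  shows "pair2 f g t = g (T_map s t f)"
proof -
  interpret g: Vector_Spaces.linear s "(*)" g
    using assms by (simp add: dual_def)
  show ?thesis
    unfolding T_map_def pair2_def lin_ext_compose[OF g.linear_axioms]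
    by (simp add: g.scale case_prod_unfold)
qed

lemma pair2_T: "g \<in> dual s \<Longrightarrow> pair2 f g r = g (T f)"
  by (rule pair2_T_map)

lemma pair2_T': "f \<in> dual s \<Longrightarrow> pair2 f g r = f (T' g)"
  using pair2_T_map[of f g "flip r"] by (simp add: pair2_flip)

lemma T_adjoint: "f \<in> dual s \<Longrightarrow> g \<in> dual s \<Longrightarrow> g (T f) = f (T' g)"
  by (metis pair2_T pair2_T')

lemma teq2_iff: "teq2 s t u \<longleftrightarrow> (\<forall>f\<in>dual s. \<forall>g\<in>dual s. pair2 f g t = pair2 f g u)"
  unfolding teq2_def null2_iff[OF fd] by (simp add: pair2_linear_simps)

lemma teq3_iff:
  "teq3 s t u \<longleftrightarrow> (\<forall>f\<in>dual s. \<forall>g\<in>dual s. \<forall>h\<in>dual s. pair3 f g h t = pair3 f g h u)"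
  unfolding teq3_def null3_iff[OF fd] by (simp add: pair3_linear_simps)

text \<open>The term \<open>id \<otimes> R(a)\<close> of the coproduct is evaluated through
  \<open>T\<close>, the term \<open>ad(a) \<otimes> id\<close> through \<open>T'\<close>. The result
  is \<open>L\<^sup>*(T f) g + ad\<^sup>*(T' g) f\<close>.\<close>

lemma star_apply:
  assumes "f \<in> dual s" "g \<in> dual s"
  shows "star f g a = g (m (T f) a) + f (m (T' g) a - m a (T' g))"
  using assms
  unfolding star_def Delta_of_def pair2_linear_simps pair2_tensor_map Rmul_def ad_apply id_def
    pair2_T[OF dual_R[OF assms(2)]] pair2_T'[OF dual_ad[OF assms(1)]]
  by (simp add: dual_diff)

lemma star_fun:
  assumes "f \<in> dual s" "g \<in> dual s"
  shows "star f g = (\<lambda>a. g (m (T f) a) + f (m (T' g) a - m a (T' g)))"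
  using star_apply[OF assms] by blast

lemma star_dual: "f \<in> dual s \<Longrightarrow> g \<in> dual s \<Longrightarrow> star f g \<in> dual s"
  unfolding star_fun by (intro dual_sum dual_L dual_ad)

text \<open>Paired with \<open>f\<close>, \<open>g\<close>, \<open>h\<close>, the Yang-Baxter tensor
  becomes \<open>h (T (star f g) - m (T f) (T g))\<close>, and functionals separate vectors.\<close>

lemma PYBE_solution_iff:
  "PYBE_solution s m r \<longleftrightarrow> (\<forall>f\<in>dual s. \<forall>g\<in>dual s. T (star f g) = m (T f) (T g))"
proof -
  let ?P = "lin_ext fscale (\<lambda>(ai, bi). lin_ext fscale (\<lambda>(aj, bj).
            pure3 ai (m bi aj) bj - pure3 ai aj (m bi bj)
          + pure3 (m ai aj) bi bj - pure3 (m aj ai) bi bj) r) r"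
  have key: "pair3 f g h ?P = h (T (star f g) - m (T f) (T g))"
    if d: "f \<in> dual s" "g \<in> dual s" "h \<in> dual s" for f g h
  proof -
    \<comment> \<open>\<open>P1\<close>, \<open>P2\<close>, \<open>P3\<close> are what the inner sum
      over \<open>(aj, bj)\<close> leaves of the four terms, the last two combining into an
      \<open>ad\<close>. Since they are functionals, the outer sum can again be evaluated through
      \<open>T\<close> and \<open>T'\<close>.\<close>
    define P1 where "P1 b = h (T (\<lambda>x. g (m b x)))" for b
    define P2 where "P2 b = h (m b (T g))" for b
    define P3 where "P3 a = h (T (\<lambda>x. f (m a x - m x a)))" for a
    have P: "P1 \<in> dual s" "P2 \<in> dual s" "P3 \<in> dual s"
      unfolding P1_def P2_def P3_def in_dual_iff
      by (auto simp: d m_add m_scale T_map_add T_map_diff T_map_scale dual_simps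
          scale_right_diff_distrib[symmetric] right_diff_distrib)
    have inner: "pair3 f g h (lin_ext fscale (\<lambda>(aj, bj).
            pure3 ai (m bi aj) bj - pure3 ai aj (m bi bj)
          + pure3 (m ai aj) bi bj - pure3 (m aj ai) bi bj) r)
        = f ai * P1 bi - f ai * P2 bi + P3 ai * g bi" for ai bi
    proof -
      have "pair3 f g h (lin_ext fscale (\<lambda>(aj, bj).
            pure3 ai (m bi aj) bj - pure3 ai aj (m bi bj)
          + pure3 (m ai aj) bi bj - pure3 (m aj ai) bi bj) r)
        = f ai * pair2 (\<lambda>x. g (m bi x)) h r - f ai * pair2 g (\<lambda>x. h (m bi x)) r
          + pair2 (\<lambda>x. f (m ai x - m x ai)) h r * g bi"
        unfolding lin_ext_compose[OF linear_pair3] pair2_def lin_ext_def[of "(*)"]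
          sum_distrib_left sum_distrib_right sum.distrib[symmetric] sum_subtractf[symmetric]
        by (rule sum.cong) (auto simp: pair3_linear_simps pair3_pure3 dual_diff d algebra_simps)
      then show ?thesis
        using d by (simp add: P1_def P2_def P3_def pair2_T dual_L)
    qed
    have "pair3 f g h ?P = pair2 f P1 r - pair2 f P2 r + pair2 P3 g r"
      unfolding lin_ext_compose[OF linear_pair3] pair2_def lin_ext_def[of "(*)"]
        sum.distrib[symmetric] sum_subtractf[symmetric]
      by (rule sum.cong) (auto simp: inner ring_distribs mult_ac)
    also have "\<dots> = P1 (T f) - P2 (T f) + P3 (T' g)"
      by (simp add: pair2_T pair2_T' P)
    also have "\<dots> = h (T (star f g) - m (T f) (T g))"
      using d by (simp add: P1_def P2_def P3_def star_fun T_map_add dual_simps)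
    finally show ?thesis .
  qed
  have "PYBE_solution s m r \<longleftrightarrow>
      (\<forall>f\<in>dual s. \<forall>g\<in>dual s. \<forall>h\<in>dual s. h (T (star f g)) = h (m (T f) (T g)))"
    unfolding PYBE_solution_def teq3_iff by (simp add: key pair3_linear_simps dual_diff)
  then show ?thesis
    by (metis dual_separates)
qed

end

section \<open>Consequences of invariance for \<open>S\<close>\<close>

locale perm_with_invariant_tensor = perm_with_tensor +
  assumes inv: "R_ad_invariant s m (skew_part r)"
begin

lemma pair2_skew_part:
  "f \<in> dual s \<Longrightarrow> g \<in> dual s \<Longrightarrow> pair2 f g (skew_part r) = 1 / 2 * g (S f)"
  by (simp add: skew_part_def pair2_linear_simps pair2_flip pair2_T dual_diff T_adjoint[of g f])

text \<open>This is the invariance condition paired with \<open>f\<close> and \<open>g\<close>; the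
  factor 1/2 cancels in characteristic zero.\<close>

lemma S_ad:
  assumes "f \<in> dual s"
  shows "S (\<lambda>x. f (m a x - m x a)) = m (S f) a"
proof (rule dual_separates)
  fix g assume g: "g \<in> dual s"
  have "pair2 f (\<lambda>x. g (m x a)) (skew_part r) = pair2 (\<lambda>x. f (m a x - m x a)) g (skew_part r)"
    using inv assms g
    by (simp add: R_ad_invariant_def teq2_iff pair2_linear_simps pair2_tensor_map Rmul_def ad_apply)
  then have "1 / 2 * g (m (S f) a) = 1 / 2 * g (S (\<lambda>x. f (m a x - m x a)))"
    using pair2_skew_part[OF assms dual_R[OF g]] pair2_skew_part[OF dual_ad[OF assms] g] by simp
  then show "g (S (\<lambda>x. f (m a x - m x a))) = g (m (S f) a)"
    by simp
qed

lemma S_skew: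
  assumes "f \<in> dual s" "g \<in> dual s"
  shows "g (S f) = - f (S g)"
  by (simp only: dual_diff assms T_adjoint[OF assms] T_adjoint[OF assms(2,1)] minus_diff_eq)

lemma L_S_eq_ad_S:
  assumes "f \<in> dual s" "g \<in> dual s"
  shows "g (m (S f) x) = f (m (S g) x - m x (S g))"
proof -
  \<comment> \<open>Skewness applied to \<open>f\<close> composed with \<open>ad(x)\<close>, where
    \<open>S_ad\<close> rewrites the left side.\<close>
  have "g (m (S f) x) = - f (m x (S g) - m (S g) x)"
    using S_skew[OF dual_ad[OF assms(1)] assms(2)] by (simp add: S_ad assms)
  then show ?thesis
    using assms by (simp add: dual_diff)
qed

text \<open>A commutator annihilates everything by left multiplication, so one term of
  \<open>L_S_eq_ad_S\<close> disappears.\<close>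

lemma L_S_commute:
  assumes "f \<in> dual s" "g \<in> dual s"
  shows "g (m (S f) (m a x - m x a)) = f (m (S g) (m a x - m x a))"
proof -
  have "m (m a x - m x a) (S g) = 0"
    by (simp add: m_simps)
  then show ?thesis
    using L_S_eq_ad_S[OF assms, of "m a x - m x a"] by simp
qed

lemma S_L:
  assumes "f \<in> dual s"
  shows "S (\<lambda>x. f (m a x)) = m a (S f)"
proof (rule dual_separates)
  fix g assume g: "g \<in> dual s"
  have "g (S (\<lambda>x. f (m a x))) = - f (m a (S g))"
    by (rule S_skew[OF dual_L[OF assms] g])
  \<comment> \<open>Adding \<open>L_S_eq_ad_S\<close> to its copy with \<open>f\<close> and
    \<open>g\<close> exchanged cancels the products with \<open>S\<close> on the left.\<close>
  moreover have "f (m a (S g)) = - g (m a (S f))"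
    using L_S_eq_ad_S[OF assms g, of a] L_S_eq_ad_S[OF g assms, of a]
    unfolding dual_diff[OF assms, of "m (S g) a"] dual_diff[OF g, of "m (S f) a"] by simp
  ultimately show "g (S (\<lambda>x. f (m a x))) = g (m a (S f))" by simp
qed

lemma S_R:
  assumes "f \<in> dual s"
  shows "S (\<lambda>x. f (m x a)) = m a (S f) - m (S f) a"
proof -
  have "(\<lambda>x. f (m x a)) = (\<lambda>x. f (m a x) - f (m a x - m x a))"
    using assms by (simp add: dual_diff)
  then show ?thesis
    using S_L[OF assms, of a] S_ad[OF assms, of a] by (simp add: T_map_diff algebra_simps)
qed

section \<open>Coassociativity from the Yang-Baxter equation\<close>

lemma T'_star:
  assumes "T (star f g) = m (T f) (T g)" and d: "f \<in> dual s" "g \<in> dual s"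
  shows "T' (star f g) = m (T' f) (T' g)"
proof -
  have "S (star f g) = S (\<lambda>x. g (m (T f) x)) + S (\<lambda>x. f (m (T' g) x - m x (T' g)))"
    unfolding star_fun[OF d] T_map_add by (rule add_diff_add)
  \<comment> \<open>With \<open>S = T - T'\<close> this sum telescopes to
    \<open>m (T f) (T g) - m (T' f) (T' g)\<close>.\<close>
  also have "\<dots> = m (T f) (S g) + m (S f) (T' g)"
    by (simp only: S_L[OF d(2)] S_ad[OF d(1)])
  finally have "T (star f g) - T' (star f g) = m (T f) (T g) - m (T' f) (T' g)"
    by (simp add: m_diff)
  then show ?thesis
    using assms(1) by simp
qed

text \<open>Multiplicativity of \<open>T\<close> handles products in the left argument of
  \<open>star\<close>, that of \<open>T'\<close> products in the right one. Associativity is then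
  formal, while the exchange of \<open>f\<close> and \<open>g\<close> uses invariance.\<close>

lemma star_assoc:
  assumes pybe: "PYBE_solution s m r" and d: "f \<in> dual s" "g \<in> dual s" "h \<in> dual s"
  shows "star (star f g) h a = star f (star g h) a" "star f (star g h) a = star (star g f) h a"
proof -
  have T: "T (star f g) = m (T f) (T g)" if "f \<in> dual s" "g \<in> dual s" for f g
    using pybe that by (simp add: PYBE_solution_iff)
  note T' = T'_star[OF T]
  have e1: "star (star f g) h a = h (m (m (T f) (T g)) a) + star f g (m (T' h) a - m a (T' h))"
    by (simp only: star_apply d star_dual T)
  have e2: "star f (star g h) a = star g h (m (T f) a) + f (m (m (T' g) (T' h)) a - m a (m (T' g) (T' h)))"
    by (simp only: star_apply d star_dual T')
  have e3: "star (star g f) h a = h (m (m (T g) (T f)) a) + star g f (m (T' h) a - m a (T' h))"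
    by (simp only: star_apply d star_dual T)
  show "star (star f g) h a = star f (star g h) a"
    unfolding e1 e2 star_apply[OF d(1,2)] star_apply[OF d(2,3)]
    by (simp add: m_simps dual_simps d)
  show "star f (star g h) a = star (star g f) h a"
    unfolding e2 e3 star_apply[OF d(2,1)] star_apply[OF d(2,3)]
    \<comment> \<open>With \<open>y\<close> the commutator of \<open>T' h\<close> and
      \<open>a\<close>, the sides differ by \<open>g (m (S f) y) - f (m (S g) y)\<close>, which
      vanishes by \<open>L_S_commute\<close>.\<close>
    by (rule eq_from_diff_eq[OF _ L_S_commute[OF d(1,2), of "T' h" a]])
      (simp add: m_simps dual_simps d algebra_simps)
qed

lemma perm_coalgebra_Delta_of:
  assumes "PYBE_solution s m r"
  shows "perm_coalgebra s (Delta_of m r)"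
  unfolding perm_coalgebra_def teq2_iff teq3_iff pair3_flip_id pair3_comult_id pair3_id_comult
    pair2_linear_simps star_def[symmetric]
  using fd star_assoc[OF assms] by (auto simp: star_dual dual_add dual_scale)

section \<open>The three bialgebra conditions read on functionals\<close>

lemma star_mult_ad_R:
  assumes d: "f \<in> dual s" "g \<in> dual s"
  shows "star f g (m a b) = star (\<lambda>x. f (m a x - m x a)) g b + star f (\<lambda>x. g (m x b)) a"
proof -
  define fa where "fa = (\<lambda>x. f (m a x - m x a))"
  have fa: "fa \<in> dual s" "\<And>x. fa x = f (m a x) - f (m x a)"
    using dual_ad[OF d(1), of a] by (simp_all add: fa_def dual_diff d)
  \<comment> \<open>By adjointness, the terms applying \<open>T\<close> to \<open>fa\<close> and
    \<open>T'\<close> to \<open>g\<close> composed with \<open>R(b)\<close> cancel in the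
    sum.\<close>
  have "g (m (T fa) b) = f (m a (T' (\<lambda>x. g (m x b)))) - f (m (T' (\<lambda>x. g (m x b))) a)"
    using T_adjoint[OF fa(1) dual_R[OF d(2), of b]] by (simp add: fa(2))
  then show ?thesis
    unfolding fa_def[symmetric] star_apply[OF d] star_apply[OF fa(1) d(2)] star_apply[OF d(1) dual_R[OF d(2)]]
    by (simp add: fa(2) m_simps dual_simps d)
qed

text \<open>On each side the \<open>ad\<close> term contains a commutator multiplied from the right
  and vanishes. By adjointness the rest differs by a product whose left factor is \<open>S\<close>
  of \<open>f\<close> composed with \<open>R(a)\<close>; that factor is itself a commutator by
  \<open>S_R\<close>.\<close>

lemma star_R_commute:
  assumes d: "f \<in> dual s" "g \<in> dual s"
  shows "star (\<lambda>x. g (m x b)) f a = star (\<lambda>x. f (m x a)) g b"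
proof -
  have "f (m (T (\<lambda>x. g (m x b))) a) = g (m (T' (\<lambda>x. f (m x a))) b)"
    using T_adjoint[OF dual_R[OF d(2)] dual_R[OF d(1)]] by simp
  moreover have "m (S (\<lambda>x. f (m x a))) b = 0"
    unfolding S_R[OF d(1)] by (simp add: m_simps)
  ultimately show ?thesis
    unfolding star_apply[OF dual_R[OF d(2)] d(1)] star_apply[OF dual_R[OF d(1)] d(2)]
    by (simp add: m_simps dual_simps d)
qed

lemma star_mult_L_ad:
  assumes d: "f \<in> dual s" "g \<in> dual s"
  shows "star f g (m a b) = star f (\<lambda>x. g (m a x)) b
      + (star (\<lambda>x. f (m b x - m x b)) g a - star g (\<lambda>x. f (m b x - m x b)) a)"
proof -
  define fb where "fb = (\<lambda>x. f (m b x - m x b))"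
  have fb: "fb \<in> dual s" "\<And>x. fb x = f (m b x) - f (m x b)"
    using dual_ad[OF d(1), of b] by (simp_all add: fb_def dual_diff d)
  \<comment> \<open>Three inputs: \<open>e1\<close> is adjointness for \<open>fb\<close>,
    \<open>e2\<close> trades \<open>T fb\<close> for \<open>T' fb\<close>, and \<open>e3\<close> is
    symmetry of the diamond product on a commutator.\<close>
  have e1: "f (m b (T' (\<lambda>x. g (m a x)))) - f (m (T' (\<lambda>x. g (m a x))) b) = g (m a (T fb))"
    using T_adjoint[OF fb(1) dual_L[OF d(2), of a]] by (simp add: fb(2))
  have e2: "T fb = m (S f) b + T' fb"
    using S_ad[OF d(1), of b] by (simp add: fb_def algebra_simps)
  have e3: "g (m (S f) (m b a)) - g (m (S f) (m a b)) = f (m (S g) (m b a)) - f (m (S g) (m a b))"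
    using L_S_eq_ad_S[OF d, of "m b a - m a b"] d by (simp add: m_simps dual_simps)
  show ?thesis
    unfolding fb_def[symmetric] star_apply[OF d] star_apply[OF d(1) dual_L[OF d(2)]]
      star_apply[OF fb(1) d(2)] star_apply[OF d(2) fb(1)]
    \<comment> \<open>The two sides differ exactly as do the sides of \<open>e1\<close> plus the
      reversed \<open>e3\<close>.\<close>
    by (rule eq_from_diff_eq[OF _ arg_cong2[where f = "(+)", OF e1 e3[symmetric]]])
      (simp add: e2 fb(2) m_simps dual_simps d algebra_simps)
qed

lemma perm_bialgebra_Delta_of:
  assumes "PYBE_solution s m r"
  shows "perm_bialgebra s m (Delta_of m r)"
  unfolding perm_bialgebra_def teq2_iff pair2_flip pair2_tensor_map pair2_linear_simps
    Rmul_def Lmul_def ad_apply id_def star_def[symmetric]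
  using perm perm_coalgebra_Delta_of[OF assms] star_mult_ad_R star_R_commute star_mult_L_ad
  by blast

section \<open>The dual space as an \<open>A\<close>-perm algebra\<close>

lemma diamond_apply: "diamond s m (r - flip r) f g x = g (m (S f) x)"
  by (simp add: diamond_def dual_map_def Lmul_def T_map_skew)

lemma diamond_fun: "diamond s m (r - flip r) f g = (\<lambda>x. g (m (S f) x))"
  by (simp add: diamond_apply fun_eq_iff)

lemma dual_map_L: "dual_map (Lmul m) a f = (\<lambda>x. f (m a x))"
  and dual_map_ad: "dual_map (ad m) a f = (\<lambda>x. f (m a x - m x a))"
  by (simp_all add: dual_map_def Lmul_def ad_apply fun_eq_iff)

lemma perm_representation_dual:
  "perm_representation s m dscale (dual s) (dual_map (Lmul m)) (dual_map (ad m))"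
  unfolding perm_representation_def bilinear_on_def linear_on_def dual_map_L dual_map_ad
  using perm fd_space_dual[OF fd]
  by (auto simp: dual_L dual_ad_expanded fun_eq_iff dscale_def m_simps dual_simps algebra_simps)

text \<open>By \<open>S_L\<close>, \<open>S\<close> turns the diamond product into the product
  \<open>m\<close>, so the perm identities are inherited from \<open>m\<close>.\<close>

lemma perm_algebra_diamond: "perm_algebra dscale (dual s) (diamond s m (r - flip r))"
proof -
  have T_map_plus: "T_map s t (f + g) = T_map s t f + T_map s t g" for t f g
    using T_map_add[of t f g] by (simp add: plus_fun_def)
  have T_map_dscale: "T_map s t (dscale c f) = s c (T_map s t f)" for t c f
    using T_map_scale[of t c f] by (simp add: dscale_def)
  have S_add: "S (f + g) = S f + S g" and S_scale: "S (dscale c f) = s c (S f)" for f g c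
    by (simp_all add: T_map_plus T_map_dscale scale_right_diff_distrib)
  show ?thesis
    unfolding perm_algebra_def bilinear_on_def linear_on_def diamond_fun S_add S_scale
    using fd_space_dual[OF fd]
    by (auto simp: dual_L S_L fun_eq_iff m_add m_scale m_assoc m_left_commute dual_add dual_scale dscale_def)
qed

lemma A_perm_algebra_dual:
  "A_perm_algebra s m dscale (dual s) (dual_map (Lmul m)) (dual_map (ad m)) (diamond s m (r - flip r))"
  unfolding A_perm_algebra_def
proof (intro conjI allI ballI perm_algebra_diamond perm_representation_dual)
  fix a f g assume d: "f \<in> dual s" "g \<in> dual s"
  let ?l = "dual_map (Lmul m) a" and ?\<rho> = "dual_map (ad m) a" and ?p = "diamond s m (r - flip r)"
  \<comment> \<open>Two rewriting stages: \<open>functionals\<close> matches differences of the form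
    \<open>m a x - m x a\<close>, which \<open>products\<close> would split.\<close>
  note functionals = dual_map_L dual_map_ad diamond_fun L_S_commute[OF d(2,1)] S_L[OF d(1)] S_ad[OF d(1)]
  note products = m_simps dual_simps d
  show "?\<rho> (?p f g) = ?\<rho> (?p g f)"
    by (simp only: functionals)
  show "?\<rho> (?p g f) = ?p f (?\<rho> g)"
    by (simp only: functionals) (simp add: products)
  show "?p (?l f) g = ?p (?\<rho> f) g"
    by (simp only: functionals) (simp add: products)
  show "?p (?\<rho> f) g = ?l (?p f g)"
    by (simp only: functionals) (simp add: products)
  show "?l (?p f g) = ?p f (?l g)"
    by (simp only: functionals) (simp add: products)
qed

end

theorem theorem4p10:
  fixes scale :: "'k::field_char_0 \<Rightarrow> 'a::ab_group_add \<Rightarrow> 'a"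
    and mult :: "'a \<Rightarrow> 'a \<Rightarrow> 'a"
    and r :: "('a \<times> 'a) \<Rightarrow>\<^sub>0 'k"
  assumes "perm_algebra scale UNIV mult"
    and "R_ad_invariant scale mult (skew_part r)"
  shows "(PYBE_solution scale mult r \<and> quasi_triangular scale mult r
            \<longleftrightarrow>
          relative_RB_operator scale mult dscale (dual scale)
            (dual_map (Lmul mult)) (dual_map (ad mult)) (diamond scale mult (r - flip r))
            (- 1) (T_map scale r))
       \<and> (relative_RB_operator scale mult dscale (dual scale)
            (dual_map (Lmul mult)) (dual_map (ad mult)) (diamond scale mult (r - flip r))
            (- 1) (T_map scale r)
            \<longleftrightarrow>
          (\<forall>f \<in> dual scale. \<forall>g \<in> dual scale.
             mult (T_map scale r f) (T_map scale r g) =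
             T_map scale r (dual_map (Lmul mult) (T_map scale r f) g
                            + dual_map (ad mult) (T_map scale r g) f
                            - diamond scale mult (r - flip r) f g)))"
proof -
  interpret perm_with_invariant_tensor scale mult r
    using assms by unfold_locales
  \<comment> \<open>By \<open>L_S_eq_ad_S\<close> the diamond product is
    \<open>ad\<^sup>*(S g) f\<close>; subtracting it replaces \<open>T g\<close> by
    \<open>T' g\<close> in the \<open>ad\<^sup>*\<close> term.\<close>
  have star: "dual_map (Lmul mult) (T f) g + dual_map (ad mult) (T g) f
      - diamond scale mult (r - flip r) f g = star f g"
    if "f \<in> dual scale" "g \<in> dual scale" for f g
    using L_S_eq_ad_S[OF that] that
    by (simp add: fun_eq_iff star_apply dual_map_L dual_map_ad diamond_apply m_diff dual_diff)
  have weight: "u + dscale (- 1) v = u - v" for u v :: "'a \<Rightarrow> 'k"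
    by (simp add: fun_eq_iff dscale_def)
  have "linear_on dscale (dual scale) scale UNIV (T_map scale r)"
    unfolding linear_on_def plus_fun_def dscale_def by (simp add: T_map_add T_map_scale)
  \<comment> \<open>The \<open>A\<close>-perm structure and the linearity of \<open>T\<close> hold
    under the assumptions, so only the operator equation remains.\<close>
  then have RB: "relative_RB_operator scale mult dscale (dual scale)
      (dual_map (Lmul mult)) (dual_map (ad mult)) (diamond scale mult (r - flip r)) (- 1) (T_map scale r)
    \<longleftrightarrow> (\<forall>f\<in>dual scale. \<forall>g\<in>dual scale. mult (T f) (T g) =
          T (dual_map (Lmul mult) (T f) g + dual_map (ad mult) (T g) f - diamond scale mult (r - flip r) f g))"
    unfolding relative_RB_operator_def weight using A_perm_algebra_dual by blast
  \<comment> \<open>Condition (1) thus reduces to the Yang-Baxter equation, which by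
    \<open>star\<close> is the operator equation.\<close>
  have "quasi_triangular scale mult r" if "PYBE_solution scale mult r"
    unfolding quasi_triangular_def using that perm_bialgebra_Delta_of inv by blast
  then show ?thesis
    unfolding RB PYBE_solution_iff by (auto simp: star)
qed

end
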